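(* Let $(G,w)$ be a connected weighted graph with $E(G)\ne\varnothing$. Define $\rho_w$ and $d_w$ on $V(G)\times V(G)$ by $\rho_w(x,x)=d_w(x,x)=0$ and, for $x\neq y$, $$\rho_w(x,y)=\inf_{P\in\mathfrak{P}_{x,y}}\max_{e\in E(P)}w(e),\qquad d_w(x,y)=\inf_{P\in\mathfrak{P}_{x,y}}\sum_{e\in E(P)}w(e).$$ Then the pseudoultrametric $\rho_w$ is the subdominant pseudoultrametric for $d_w$, i.e., $\rho_w\preceq d_w$ and $\rho\preceq\rho_w$ for every pseudoultrametric $\rho$ on $V(G)$ satisfying $\rho\preceq d_w$.
   Context: A graph $G=(V(G),E(G))$ has a nonempty (possibly infinite) vertex set $V(G)$, and its edge set $E(G)$ (possibly empty) is a set of unordered pairs of distinct vertices. A path is a finite graph with at least one edge whose vertices can be enumerated without repetition as $v_1,\dots,v_n$ so that $\{v_i,v_j\}$ is an edge iff $|i-j|=1$; it connects $v_1$ and $v_n$. For distinct $x,y\in V(G)$, $\mathfrak{P}_{x,y}$ is the set of paths in $G$ (subgraphs of $G$, not necessarily induced) connecting $x$ and $y$. $G$ is connected if any two distinct vertices are connected by a path in $G$. A weighted graph $(G,w)$ is a graph $G$ with a function (weight) $w:E(G)\to\mathbb{R}^+=[0,+\infty)$. A pseudoultrametric on a set $X$ is a function $d:X\times X\to\mathbb{R}^+$ with $d(x,y)=d(y,x)$, $d(x,x)=0$ and $d(x,y)\le\max\{d(x,z),d(z,y)\}$ for all $x,y,z\in X$. The function $d_w$ is the shortest-path pseudometric.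 The order is pointwise: $d_1\preceq d_2$ iff $d_1(x,y)\le d_2(x,y)$ for all $x,y\in V(G)$. *)

theory Defs
  imports Complex_Main
begin

record 'a graph =
  verts :: "'a set"
  edges :: "'a set set"

definition is_graph :: "'a graph \<Rightarrow> bool" where
  "is_graph G \<longleftrightarrow> verts G \<noteq> {} \<and>
     edges G \<subseteq> {{u, v} | u v. u \<in> verts G \<and> v \<in> verts G \<and> u \<noteq> v}"

definition subgraph :: "'a graph \<Rightarrow> 'a graph \<Rightarrow> bool" where
  "subgraph H G \<longleftrightarrow> is_graph H \<and> verts H \<subseteq> verts G \<and> edges H \<subseteq> edges G"

text \<open>A path is itself a graph; the list enumerates its vertices, so that the path
  connects the first and the last entry of the list.\<close>
definition path_enumeration :: "'a graph \<Rightarrow> 'a list \<Rightarrow> bool" where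
  "path_enumeration P vs \<longleftrightarrow>
     is_graph P \<and> finite (verts P) \<and> edges P \<noteq> {} \<and>
     distinct vs \<and> set vs = verts P \<and>
     (\<forall>i < length vs. \<forall>j < length vs.
        {vs ! i, vs ! j} \<in> edges P \<longleftrightarrow> \<bar>int i - int j\<bar> = 1)"

definition paths_between :: "'a graph \<Rightarrow> 'a \<Rightarrow> 'a \<Rightarrow> 'a graph set" where
  "paths_between G x y =
     {P. subgraph P G \<and> (\<exists>vs. path_enumeration P vs \<and> hd vs = x \<and> last vs = y)}"

definition connected_graph :: "'a graph \<Rightarrow> bool" where
  "connected_graph G \<longleftrightarrow> is_graph G \<and>
     (\<forall>x\<in>verts G. \<forall>y\<in>verts G. x \<noteq> y \<longrightarrow> paths_between G x y \<noteq> {})"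

definition weighted_graph :: "'a graph \<Rightarrow> ('a set \<Rightarrow> real) \<Rightarrow> bool" where
  "weighted_graph G w \<longleftrightarrow> is_graph G \<and> (\<forall>e\<in>edges G. 0 \<le> w e)"

text \<open>Functions on \<open>X \<times> X\<close> are total functions of which only the values
  on \<open>X\<close> matter.\<close>
definition pseudoultrametric_on :: "'a set \<Rightarrow> ('a \<Rightarrow> 'a \<Rightarrow> real) \<Rightarrow> bool" where
  "pseudoultrametric_on X d \<longleftrightarrow>
     (\<forall>x\<in>X. \<forall>y\<in>X. 0 \<le> d x y) \<and>
     (\<forall>x\<in>X. \<forall>y\<in>X. d x y = d y x) \<and>
     (\<forall>x\<in>X. d x x = 0) \<and>
     (\<forall>x\<in>X. \<forall>y\<in>X. \<forall>z\<in>X. d x y \<le> max (d x z) (d z y))"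

definition pointwise_le_on ::
    "'a set \<Rightarrow> ('a \<Rightarrow> 'a \<Rightarrow> real) \<Rightarrow> ('a \<Rightarrow> 'a \<Rightarrow> real) \<Rightarrow> bool" where
  "pointwise_le_on X d1 d2 \<longleftrightarrow> (\<forall>x\<in>X. \<forall>y\<in>X. d1 x y \<le> d2 x y)"

definition subdominant_pseudoultrametric ::
    "'a set \<Rightarrow> ('a \<Rightarrow> 'a \<Rightarrow> real) \<Rightarrow> ('a \<Rightarrow> 'a \<Rightarrow> real) \<Rightarrow> bool" where
  "subdominant_pseudoultrametric X r d \<longleftrightarrow>
     pseudoultrametric_on X r \<and> pointwise_le_on X r d \<and>
     (\<forall>r'. pseudoultrametric_on X r' \<and> pointwise_le_on X r' d \<longrightarrow> pointwise_le_on X r' r)"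

text \<open>On a connected weighted graph both infima below range over nonempty sets of
  reals bounded below by \<open>0\<close>.\<close>
definition minimax_dist :: "'a graph \<Rightarrow> ('a set \<Rightarrow> real) \<Rightarrow> 'a \<Rightarrow> 'a \<Rightarrow> real" where
  "minimax_dist G w x y =
     (if x = y then 0 else INF P\<in>paths_between G x y. Max (w ` edges P))"

definition shortest_path_dist :: "'a graph \<Rightarrow> ('a set \<Rightarrow> real) \<Rightarrow> 'a \<Rightarrow> 'a \<Rightarrow> real" where
  "shortest_path_dist G w x y =
     (if x = y then 0 else INF P\<in>paths_between G x y. \<Sum>e\<in>edges P. w e)"

end

theory Submission
  imports Defs
begin

text \<open>
  Everything reduces to reachability through light edges. For a threshold \<open>c \<ge> 0\<close>, two distinct vertices
  are joined by a path all of whose weights are at most \<open>c\<close> iff they are related by the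
  reflexive transitive closure of adjacency through edges of weight at most \<open>c\<close>
  (\<open>rtrancl_adj_iff_path\<close>); shortening a walk to a path is the only combinatorial content here.
  Consequently \<open>\<rho>\<^sub>w(x, y) < c\<close> implies that \<open>y\<close> is reachable from \<open>x\<close> at threshold \<open>c\<close>, and
  reachability at threshold \<open>c\<close> implies \<open>\<rho>\<^sub>w(x, y) \<le> c\<close> (\<open>light_reachable_if_minimax_less\<close>,
  \<open>minimax_le_if_light_reachable\<close>).

  Since reachability at a fixed threshold is an equivalence relation, \<open>\<rho>\<^sub>w\<close> is a
  pseudoultrametric. The bound \<open>\<rho>\<^sub>w \<le> d\<^sub>w\<close> holds path by path, because the maximum of finitely many
  nonnegative weights is at most their sum. If \<open>\<rho>\<close> is a pseudoultrametric below \<open>d\<^sub>w\<close>, then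
  \<open>\<rho>(u, v) \<le> d\<^sub>w(u, v) \<le> w({u, v})\<close> on every edge, so the ultrametric inequality
  propagates \<open>\<rho> \<le> c\<close> along any walk through edges of weight at most \<open>c\<close>; letting \<open>c\<close> decrease to
  \<open>\<rho>\<^sub>w(x, y)\<close> gives \<open>\<rho> \<le> \<rho>\<^sub>w\<close>.
\<close>

section \<open>Walks and paths\<close>

definition adj :: "'a set set \<Rightarrow> ('a \<times> 'a) set" where
  "adj F = {(u, v). {u, v} \<in> F}"

lemma sym_adj: "sym (adj F)"
  by (auto simp: sym_def adj_def insert_commute)

text \<open>A walk can be shortened to a repetition-free one while it is being built: when the next
  vertex has been visited before, everything after that visit is dropped.\<close>

lemma rtrancl_distinct_list:
  assumes "(x, y) \<in> R\<^sup>*"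
  shows "\<exists>vs. vs \<noteq> [] \<and> distinct vs \<and> hd vs = x \<and> last vs = y \<and>
              (\<forall>i. Suc i < length vs \<longrightarrow> (vs ! i, vs ! Suc i) \<in> R)"
  using assms
proof (induction rule: rtrancl_induct)
  case base
  show ?case by (rule exI[of _ "[x]"]) simp
next
  case (step y z)
  then obtain vs where vs: "vs \<noteq> []" "distinct vs" "hd vs = x" "last vs = y"
    and R: "\<And>i. Suc i < length vs \<Longrightarrow> (vs ! i, vs ! Suc i) \<in> R" by blast
  show ?case
  proof (cases "z \<in> set vs")
    case True
    then obtain k where k: "k < length vs" "vs ! k = z" by (auto simp: in_set_conv_nth)
    let ?us = "take (Suc k) vs"
    have "last ?us = z" using k by (simp add: take_Suc_conv_app_nth)
    moreover have "hd ?us = x" using vs by simp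
    ultimately show ?thesis using vs R
      by (intro exI[of _ ?us]) auto
  next
    case False
    have "((vs @ [z]) ! i, (vs @ [z]) ! Suc i) \<in> R" if i: "Suc i < length (vs @ [z])" for i
    proof (cases "Suc i < length vs")
      case True
      then show ?thesis using R by (simp add: nth_append)
    next
      case False
      then have "i = length vs - 1" "length vs = Suc i" using i vs by auto
      then show ?thesis using step(2) vs by (simp add: nth_append last_conv_nth)
    qed
    then show ?thesis using vs False by (intro exI[of _ "vs @ [z]"]) auto
  qed
qed

definition list_path :: "'a list \<Rightarrow> 'a graph" where
  "list_path vs = \<lparr>verts = set vs, edges = {{vs ! i, vs ! Suc i} | i. Suc i < length vs}\<rparr>"

lemma path_enumeration_list_path:
  assumes "distinct vs" and "2 \<le> length vs"
  shows "path_enumeration (list_path vs) vs"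
proof -
  have inj: "vs ! i = vs ! j \<longleftrightarrow> i = j" if "i < length vs" "j < length vs" for i j
    using assms that by (simp add: nth_eq_iff_index_eq)
  have "{vs ! i, vs ! j} \<in> edges (list_path vs) \<longleftrightarrow> \<bar>int i - int j\<bar> = 1"
    if ij: "i < length vs" "j < length vs" for i j
  proof
    assume "{vs ! i, vs ! j} \<in> edges (list_path vs)"
    then obtain k where "Suc k < length vs" "{vs ! i, vs ! j} = {vs ! k, vs ! Suc k}"
      by (auto simp: list_path_def)
    then have "i = k \<and> j = Suc k \<or> i = Suc k \<and> j = k"
      using ij by (auto simp: doubleton_eq_iff inj)
    then show "\<bar>int i - int j\<bar> = 1" by auto
  next
    assume "\<bar>int i - int j\<bar> = 1"
    then have "j = Suc i \<or> i = Suc j" by linarith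
    then show "{vs ! i, vs ! j} \<in> edges (list_path vs)"
      using ij by (auto simp: list_path_def insert_commute)
  qed
  moreover have "is_graph (list_path vs)"
    unfolding is_graph_def
  proof
    show "verts (list_path vs) \<noteq> {}" using assms(2) by (auto simp: list_path_def)
    show "edges (list_path vs)
        \<subseteq> {{u, v} | u v. u \<in> verts (list_path vs) \<and> v \<in> verts (list_path vs) \<and> u \<noteq> v}"
    proof
      fix e assume "e \<in> edges (list_path vs)"
      then obtain k where k: "Suc k < length vs" "e = {vs ! k, vs ! Suc k}"
        by (auto simp: list_path_def)
      then have "vs ! k \<noteq> vs ! Suc k" by (simp add: inj)
      with k show "e \<in> {{u, v} | u v.
          u \<in> verts (list_path vs) \<and> v \<in> verts (list_path vs) \<and> u \<noteq> v}"
        by (force simp: list_path_def)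
    qed
  qed
  moreover have "edges (list_path vs) \<noteq> {}"
    using assms(2) by (auto simp: list_path_def intro!: exI[of _ 0])
  ultimately show ?thesis
    using assms(1) by (simp add: path_enumeration_def list_path_def)
qed

lemma list_path_in_paths_between:
  assumes G: "is_graph G" and vs: "distinct vs" "2 \<le> length vs"
    and E: "edges (list_path vs) \<subseteq> edges G"
  shows "list_path vs \<in> paths_between G (hd vs) (last vs)"
proof -
  have enum: "path_enumeration (list_path vs) vs"
    by (rule path_enumeration_list_path[OF vs])
  have "set vs \<subseteq> verts G"
  proof
    fix v assume "v \<in> set vs"
    then obtain i where i: "i < length vs" "v = vs ! i" by (auto simp: in_set_conv_nth)
    \<comment> \<open>Every vertex of the list is an endpoint of some edge, as there are at least two.\<close>
    have "\<exists>e\<in>edges (list_path vs). v \<in> e"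
    proof (cases "Suc i < length vs")
      case True
      then show ?thesis using i by (auto simp: list_path_def)
    next
      case False
      then have "Suc (i - 1) = i" using i vs(2) by simp
      then have "{vs ! (i - 1), vs ! i} \<in> edges (list_path vs)"
        using i by (auto simp: list_path_def intro!: exI[of _ "i - 1"])
      then show ?thesis using i by blast
    qed
    then show "v \<in> verts G" using E G by (fastforce simp: is_graph_def)
  qed
  then have "subgraph (list_path vs) G"
    using E enum by (simp add: subgraph_def path_enumeration_def)
  then show ?thesis using enum by (auto simp: paths_between_def)
qed

lemma path_imp_rtrancl_adj:
  assumes "P \<in> paths_between G x y"
  shows "(x, y) \<in> (adj (edges P))\<^sup>*"
proof -
  obtain vs where enum: "path_enumeration P vs" and ends: "hd vs = x" "last vs = y"
    using assms by (auto simp: paths_between_def)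
  have ne: "vs \<noteq> []" using enum by (auto simp: path_enumeration_def is_graph_def)
  have "(vs ! 0, vs ! i) \<in> (adj (edges P))\<^sup>*" if "i < length vs" for i
    using that
  proof (induction i)
    case (Suc i)
    then have "(vs ! i, vs ! Suc i) \<in> adj (edges P)"
      using enum by (simp add: path_enumeration_def adj_def)
    with Suc show ?case by (meson Suc_lessD rtrancl.rtrancl_into_rtrancl)
  qed simp
  from this[of "length vs - 1"] show ?thesis
    using ne ends by (simp add: hd_conv_nth last_conv_nth)
qed

text \<open>This turns paths, which are awkward to concatenate, into a relation that is closed under
  composition by construction.\<close>

lemma rtrancl_adj_iff_path:
  assumes G: "is_graph G" and F: "F \<subseteq> edges G" and xy: "x \<noteq> y"
  shows "(x, y) \<in> (adj F)\<^sup>* \<longleftrightarrow> (\<exists>P\<in>paths_between G x y. edges P \<subseteq> F)"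
proof
  assume "(x, y) \<in> (adj F)\<^sup>*"
  then obtain vs where vs: "vs \<noteq> []" "distinct vs" "hd vs = x" "last vs = y"
    and R: "\<And>i. Suc i < length vs \<Longrightarrow> (vs ! i, vs ! Suc i) \<in> adj F"
    using rtrancl_distinct_list by metis
  have "length vs \<noteq> 1" using vs xy by (auto simp: length_Suc_conv)
  then have len: "2 \<le> length vs" using vs(1) by (cases vs; cases "tl vs") auto
  have E: "edges (list_path vs) \<subseteq> F" using R by (auto simp: list_path_def adj_def)
  show "\<exists>P\<in>paths_between G x y. edges P \<subseteq> F"
    using list_path_in_paths_between[OF G vs(2) len] E F vs by blast
next
  assume "\<exists>P\<in>paths_between G x y. edges P \<subseteq> F"
  then obtain P where P: "P \<in> paths_between G x y" "edges P \<subseteq> F" by blast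
  then have "adj (edges P) \<subseteq> adj F" by (auto simp: adj_def)
  from subsetD[OF rtrancl_mono[OF this] path_imp_rtrancl_adj[OF P(1)]]
  show "(x, y) \<in> (adj F)\<^sup>*" .
qed

section \<open>Weights along paths\<close>

lemma path_edges:
  assumes "P \<in> paths_between G x y"
  shows "finite (edges P)" and "edges P \<noteq> {}" and "edges P \<subseteq> edges G"
proof -
  have "finite (verts P)" "edges P \<subseteq> Pow (verts P)"
    using assms by (auto simp: paths_between_def path_enumeration_def is_graph_def)
  then show "finite (edges P)" by (meson finite_Pow_iff finite_subset)
qed (use assms in \<open>auto simp: paths_between_def path_enumeration_def subgraph_def\<close>)

lemma path_max_bounds:
  assumes w: "weighted_graph G w" and P: "P \<in> paths_between G x y"
  shows "0 \<le> Max (w ` edges P)" and "Max (w ` edges P) \<le> (\<Sum>e\<in>edges P. w e)"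
proof -
  note E = path_edges[OF P]
  have nn: "0 \<le> w e" if "e \<in> edges P" for e
    using w E(3) that by (auto simp: weighted_graph_def)
  from E have "Max (w ` edges P) \<in> w ` edges P" by (intro Max_in) auto
  then obtain e where e: "e \<in> edges P" "Max (w ` edges P) = w e" by auto
  then show "0 \<le> Max (w ` edges P)" using nn by simp
  show "Max (w ` edges P) \<le> (\<Sum>e\<in>edges P. w e)"
    using e E(1) nn member_le_sum[of e "edges P" w] by simp
qed

lemma bdd_below_path_weights:
  assumes w: "weighted_graph G w"
  shows "bdd_below ((\<lambda>P. Max (w ` edges P)) ` paths_between G x y)"
    and "bdd_below ((\<lambda>P. \<Sum>e\<in>edges P. w e) ` paths_between G x y)"
  using path_max_bounds[OF w] by (fastforce intro!: bdd_belowI2[where m = 0])+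

lemma minimax_dist_nonneg:
  assumes "weighted_graph G w" and "connected_graph G" and "x \<in> verts G" and "y \<in> verts G"
  shows "0 \<le> minimax_dist G w x y"
  using assms path_max_bounds(1)[OF assms(1)]
  by (auto simp: minimax_dist_def connected_graph_def intro!: cINF_greatest)

lemma minimax_dist_le_shortest_path_dist:
  assumes w: "weighted_graph G w" and G: "connected_graph G" and "x \<in> verts G" and "y \<in> verts G"
  shows "minimax_dist G w x y \<le> shortest_path_dist G w x y"
proof (cases "x = y")
  case False
  then have "paths_between G x y \<noteq> {}" using assms by (simp add: connected_graph_def)
  then have "(INF P\<in>paths_between G x y. Max (w ` edges P))
      \<le> (INF P\<in>paths_between G x y. \<Sum>e\<in>edges P. w e)"
    by (rule cINF_mono[OF _ bdd_below_path_weights(1)[OF w]]) (use path_max_bounds(2)[OF w] in blast)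
  with False show ?thesis by (simp add: minimax_dist_def shortest_path_dist_def)
qed (simp add: minimax_dist_def shortest_path_dist_def)

text \<open>The edge itself is a competitor in the infimum.\<close>

lemma shortest_path_dist_edge_le:
  assumes w: "weighted_graph G w" and e: "{u, v} \<in> edges G"
  shows "shortest_path_dist G w u v \<le> w {u, v}"
proof -
  have G: "is_graph G" using w by (simp add: weighted_graph_def)
  with e have uv: "u \<noteq> v" by (auto simp: is_graph_def doubleton_eq_iff)
  have E: "edges (list_path [u, v]) = {{u, v}}" by (auto simp: list_path_def)
  have P: "list_path [u, v] \<in> paths_between G u v"
    using list_path_in_paths_between[OF G, of "[u, v]"] uv e E by simp
  have "shortest_path_dist G w u v = (INF P\<in>paths_between G u v. \<Sum>e\<in>edges P. w e)"
    using uv by (simp add: shortest_path_dist_def)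
  also have "\<dots> \<le> (\<Sum>e\<in>edges (list_path [u, v]). w e)"
    by (rule cINF_lower[OF bdd_below_path_weights(2)[OF w] P])
  finally show ?thesis by (simp add: E)
qed

section \<open>Minimax distance as a reachability threshold\<close>

definition light_reach :: "'a graph \<Rightarrow> ('a set \<Rightarrow> real) \<Rightarrow> real \<Rightarrow> ('a \<times> 'a) set" where
  "light_reach G w c = (adj {e \<in> edges G. w e \<le> c})\<^sup>*"

text \<open>The inequality is strict because the infimum over the paths need not be attained.\<close>

lemma light_reachable_if_minimax_less:
  assumes G: "connected_graph G"
    and x: "x \<in> verts G" and y: "y \<in> verts G" and less: "minimax_dist G w x y < c"
  shows "(x, y) \<in> light_reach G w c"
proof (cases "x = y")
  case False
  then have "paths_between G x y \<noteq> {}" using G x y by (simp add: connected_graph_def)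
  moreover have "(INF P\<in>paths_between G x y. Max (w ` edges P)) < c"
    using less False by (simp add: minimax_dist_def)
  ultimately obtain P where P: "P \<in> paths_between G x y" "Max (w ` edges P) < c"
    using cInf_lessD[of "(\<lambda>P. Max (w ` edges P)) ` paths_between G x y" c] by auto
  have "edges P \<subseteq> {e \<in> edges G. w e \<le> c}"
    using P path_edges[OF P(1)] by (auto intro: order_trans[OF Max_ge])
  then show ?thesis
    using P(1) G False rtrancl_adj_iff_path[of G _ x y]
    unfolding light_reach_def by (auto simp: connected_graph_def)
qed (simp add: light_reach_def)

lemma minimax_le_if_light_reachable:
  assumes w: "weighted_graph G w" and c: "0 \<le> c" and reach: "(x, y) \<in> light_reach G w c"
  shows "minimax_dist G w x y \<le> c"
proof (cases "x = y")
  case False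
  have "is_graph G" using w by (simp add: weighted_graph_def)
  then obtain P where P: "P \<in> paths_between G x y" "edges P \<subseteq> {e \<in> edges G. w e \<le> c}"
    using rtrancl_adj_iff_path[of G "{e \<in> edges G. w e \<le> c}" x y] reach False
    by (auto simp: light_reach_def)
  have "minimax_dist G w x y \<le> Max (w ` edges P)"
    using False cINF_lower[OF bdd_below_path_weights(1)[OF w] P(1)]
    by (simp add: minimax_dist_def)
  also have "\<dots> \<le> c" using P path_edges[OF P(1)] by auto
  finally show ?thesis .
qed (simp add: minimax_dist_def c)

lemma light_reach_commute: "(x, y) \<in> light_reach G w c \<longleftrightarrow> (y, x) \<in> light_reach G w c"
  unfolding light_reach_def using sym_rtrancl[OF sym_adj] by (meson symD)

lemma light_reach_trans:
  "(x, z) \<in> light_reach G w c \<Longrightarrow> (z, y) \<in> light_reach G w c \<Longrightarrow> (x, y) \<in> light_reach G w c"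
  unfolding light_reach_def by (rule rtrancl_trans)

text \<open>Symmetry and the ultrametric inequality are the symmetry and the transitivity of
  reachability, read off at every threshold above the right-hand side.\<close>

lemma pseudoultrametric_on_minimax_dist:
  assumes w: "weighted_graph G w" and G: "connected_graph G"
  shows "pseudoultrametric_on (verts G) (minimax_dist G w)"
proof -
  let ?d = "minimax_dist G w"
  note nonneg = minimax_dist_nonneg[OF w G]
  note reach = light_reachable_if_minimax_less[OF G, where w = w]
  have sym_le: "?d x y \<le> ?d y x" if x: "x \<in> verts G" and y: "y \<in> verts G" for x y
  proof (rule dense_ge)
    fix c assume c: "?d y x < c"
    then have "(x, y) \<in> light_reach G w c"
      using reach[OF y x] light_reach_commute by metis
    then show "?d x y \<le> c"
      using minimax_le_if_light_reachable[OF w] nonneg[OF y x] c by simp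
  qed
  have tri: "?d x y \<le> max (?d x z) (?d z y)"
    if x: "x \<in> verts G" and y: "y \<in> verts G" and z: "z \<in> verts G" for x y z
  proof (rule dense_ge)
    fix c assume c: "max (?d x z) (?d z y) < c"
    then have "(x, y) \<in> light_reach G w c"
      using reach[OF x z, of c] reach[OF z y, of c] light_reach_trans[of x z G w c y] by simp
    then show "?d x y \<le> c"
      using minimax_le_if_light_reachable[OF w] nonneg[OF x z] c by simp
  qed
  show ?thesis
    unfolding pseudoultrametric_on_def
    using nonneg sym_le tri by (simp add: antisym) (simp add: minimax_dist_def)
qed

text \<open>The ultrametric inequality takes a maximum rather than a sum over the steps of a walk, so a
  bound on the edges is a bound on the whole walk, however long.\<close>

lemma pseudoultrametric_le_on_light_reach:
  assumes G: "is_graph G" and r: "pseudoultrametric_on (verts G) r"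
    and edge: "\<And>u v. {u, v} \<in> edges G \<Longrightarrow> r u v \<le> w {u, v}"
    and c: "0 \<le> c" and x: "x \<in> verts G" and reach: "(x, y) \<in> light_reach G w c"
  shows "r x y \<le> c"
proof -
  have "y \<in> verts G \<and> r x y \<le> c"
    using reach unfolding light_reach_def
  proof (induction rule: rtrancl_induct)
    case base
    show ?case using r x c by (simp add: pseudoultrametric_on_def)
  next
    case (step y z)
    then have e: "{y, z} \<in> edges G" "w {y, z} \<le> c" by (auto simp: adj_def)
    then have z: "z \<in> verts G" using G by (auto simp: is_graph_def doubleton_eq_iff)
    have "r x z \<le> max (r x y) (r y z)"
      using r x z step.IH by (simp add: pseudoultrametric_on_def)
    also have "\<dots> \<le> c" using step.IH edge[OF e(1)] e(2) by simp
    finally show ?case using z by simp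
  qed
  then show ?thesis by simp
qed

theorem corollary2p8:
  fixes G :: "'a graph" and w :: "'a set \<Rightarrow> real"
  assumes "weighted_graph G w" and "connected_graph G" and "edges G \<noteq> {}"
  shows "subdominant_pseudoultrametric (verts G) (minimax_dist G w) (shortest_path_dist G w)"
proof -
  note w = assms(1) and conn = assms(2)
  have G: "is_graph G" using w by (simp add: weighted_graph_def)
  have maximal: "r x y \<le> minimax_dist G w x y"
    if r: "pseudoultrametric_on (verts G) r"
      and le: "pointwise_le_on (verts G) r (shortest_path_dist G w)"
      and x: "x \<in> verts G" and y: "y \<in> verts G" for r x y
  proof (rule dense_ge)
    fix c assume c: "minimax_dist G w x y < c"
    have edge: "r u v \<le> w {u, v}" if e: "{u, v} \<in> edges G" for u v
    proof -
      have "u \<in> verts G" "v \<in> verts G"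
        using G e by (auto simp: is_graph_def doubleton_eq_iff)
      then have "r u v \<le> shortest_path_dist G w u v" using le by (simp add: pointwise_le_on_def)
      also have "\<dots> \<le> w {u, v}" by (rule shortest_path_dist_edge_le[OF w e])
      finally show ?thesis .
    qed
    have "0 \<le> c" using minimax_dist_nonneg[OF w conn x y] c by simp
    then show "r x y \<le> c"
      using pseudoultrametric_le_on_light_reach[OF G r edge _ x]
        light_reachable_if_minimax_less[OF conn x y c] by blast
  qed
  then show ?thesis
    using pseudoultrametric_on_minimax_dist[OF w conn] minimax_dist_le_shortest_path_dist[OF w conn]
    by (auto simp: subdominant_pseudoultrametric_def pointwise_le_on_def)
qed

end
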